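(* For $2\sqrt3-2\le R\le\frac32$, the following algorithm is $\frac{2}{R}$-competitive for the proportional\&removable online knapsack problem with a buffer of capacity $R$. Call an item $e$ small if $s(e)\le 1-R/2$, medium if $1-R/2<s(e)<R/2$, large if $s(e)\ge R/2$; let $S$ be the set of small items, and split the medium items into $M_1=\{e:1-R/2<s(e)<R/4\}$, $M_2=\{e:R/4\le s(e)<1/2\}$, $M_3=\{e:1/2\le s(e)<R^2/4\}$, $M_4=\{e:R^2/4\le s(e)<R/2\}$. Start with $B_0=\emptyset$. In round $i$: if there exists $B'\subseteq B_{i-1}\cup\{e_i\}$ with $R/2\le s(B')\le 1$, set $B_i=B'$ for such a $B'$. Otherwise: set $B_i=\emptyset$ and $A_j=(B_{i-1}\cup\{e_i\})\cap M_j$ for $j=1,2,3,4$. (a) If $A_1\ne\emptyset$, let $a$ be an item of minimum size in $A_1$ and add it to $B_i$; if moreover $|A_1|\ge 2$, let $b$ be an item of minimum size in $A_1\setminus\{a\}$, and add $b$ to $B_i$ if $A_2=\emptyset$ or $s(a)+s(b)\le\min_{e\in A_4}s(e)$ (where the minimum over an empty set is $+\infty$). (b) If $A_2\ne\emptyset$, add an item of minimum size in $A_2$ to $B_i$. (c) If $A_3\ne\emptyset$ and ($A_1\cup A_2=\emptyset$ or $A_4=\emptyset$), add an item of minimum size in $A_3$ to $B_i$. (d) If $A_4\ne\emptyset$ and $|B_i\cap(M_1\cup M_2)|\le 2$, add an item of minimum size in $A_4$ to $B_i$. (e) Add all items of $(B_{i-1}\cup\{e_i\})\cap S$ to $B_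i$.
   Context: Online knapsack problem with a resource buffer: there is a knapsack of capacity $1$ and a buffer of capacity $R\ge 1$. Items $e_1,\dots,e_n$ arrive one by one; each item $e$ has size $0<s(e)\le 1$ and value $v(e)\ge 0$; $s(B),v(B)$ denote sums over a set $B$. A deterministic online algorithm maintains buffer contents $B_0=\emptyset,B_1,\dots,B_n$, with $B_i$ chosen after seeing only $e_1,\dots,e_i$, $B_i\subseteq B_{i-1}\cup\{e_i\}$ and $s(B_i)\le R$ (removable setting). $\mathrm{ALG}(I)=\max\{v(B)\mid B\subseteq B_n,\ s(B)\le 1\}$, $\mathrm{OPT}(I)=\max\{v(B)\mid B\subseteq\{e_1,\dots,e_n\},\ s(B)\le 1\}$. "Proportional" means $v(e)=s(e)$ for every item. An algorithm is $c$-competitive if $\mathrm{OPT}(I)\le c\cdot\mathrm{ALG}(I)$ for every input $I$. Ties are broken arbitrarily. *)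

theory Defs
  imports Complex_Main
begin

datatype item = Item (isize: real) (ivalue: real)

text \<open>
  An input is the list of arriving items.  Distinct items may agree in size and value, so an item
  is identified with its position in the list, and sets of items are sets of positions.
\<close>

definition inputs :: "item list set" where
  "inputs = {I. \<forall>e\<in>set I. 0 < isize e \<and> isize e \<le> 1 \<and> 0 \<le> ivalue e}"

definition proportional_inputs :: "item list set" where
  "proportional_inputs = {I \<in> inputs. \<forall>e\<in>set I. ivalue e = isize e}"

definition total_size :: "item list \<Rightarrow> nat set \<Rightarrow> real" where
  "total_size I B = (\<Sum>i\<in>B. isize (I ! i))"

definition total_value :: "item list \<Rightarrow> nat set \<Rightarrow> real" where
  "total_value I B = (\<Sum>i\<in>B. ivalue (I ! i))"

definition best_value :: "item list \<Rightarrow> nat set \<Rightarrow> real" where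
  "best_value I C = Max {total_value I B |B. B \<subseteq> C \<and> total_size I B \<le> 1}"

definition OPT :: "item list \<Rightarrow> real" where
  "OPT I = best_value I {..<length I}"

text \<open>
  A deterministic online algorithm is a function mapping the sequence of items seen so far to the
  buffer contents.  The parameter \<open>P\<close> is the (prefix-closed) class of admissible inputs.
\<close>

definition removable_online_algorithm ::
    "item list set \<Rightarrow> real \<Rightarrow> (item list \<Rightarrow> nat set) \<Rightarrow> bool" where
  "removable_online_algorithm P R alg \<longleftrightarrow>
     alg [] = {} \<and>
     (\<forall>I e. I @ [e] \<in> P \<longrightarrow>
        alg (I @ [e]) \<subseteq> insert (length I) (alg I) \<and>
        total_size (I @ [e]) (alg (I @ [e])) \<le> R)"

definition ALG :: "(item list \<Rightarrow> nat set) \<Rightarrow> item list \<Rightarrow> real" where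
  "ALG alg I = best_value I (alg I)"

definition competitive :: "item list set \<Rightarrow> real \<Rightarrow> (item list \<Rightarrow> nat set) \<Rightarrow> bool" where
  "competitive P c alg \<longleftrightarrow> (\<forall>I\<in>P. OPT I \<le> c * ALG alg I)"

definition small :: "real \<Rightarrow> (nat \<Rightarrow> real) \<Rightarrow> nat set" where
  "small R s = {e. s e \<le> 1 - R / 2}"

definition M1 :: "real \<Rightarrow> (nat \<Rightarrow> real) \<Rightarrow> nat set" where
  "M1 R s = {e. 1 - R / 2 < s e \<and> s e < R / 4}"

definition M2 :: "real \<Rightarrow> (nat \<Rightarrow> real) \<Rightarrow> nat set" where
  "M2 R s = {e. R / 4 \<le> s e \<and> s e < 1 / 2}"

definition M3 :: "real \<Rightarrow> (nat \<Rightarrow> real) \<Rightarrow> nat set" where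
  "M3 R s = {e. 1 / 2 \<le> s e \<and> s e < R\<^sup>2 / 4}"

definition M4 :: "real \<Rightarrow> (nat \<Rightarrow> real) \<Rightarrow> nat set" where
  "M4 R s = {e. R\<^sup>2 / 4 \<le> s e \<and> s e < R / 2}"

definition min_item :: "(nat \<Rightarrow> real) \<Rightarrow> nat set \<Rightarrow> nat \<Rightarrow> bool" where
  "min_item s A x \<longleftrightarrow> is_arg_min s (\<lambda>e. e \<in> A) x"

text \<open>
  The steps are relations between the buffer under construction before and after the step, so that
  every way of breaking ties is covered.
\<close>

definition add_min ::
    "(nat \<Rightarrow> real) \<Rightarrow> nat set \<Rightarrow> bool \<Rightarrow> nat set \<Rightarrow> nat set \<Rightarrow> bool" where
  "add_min s A c B B' \<longleftrightarrow>
     (if A \<noteq> {} \<and> c then \<exists>x. min_item s A x \<and> B' = insert x B else B' = B)"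

definition step_a ::
    "(nat \<Rightarrow> real) \<Rightarrow> nat set \<Rightarrow> nat set \<Rightarrow> nat set \<Rightarrow> nat set \<Rightarrow> bool" where
  "step_a s A1 A2 A4 B' \<longleftrightarrow>
     (if A1 = {} then B' = {}
      else \<exists>a. min_item s A1 a \<and>
        (if card A1 \<ge> 2 then
           \<exists>b. min_item s (A1 - {a}) b \<and>
             B' = (if A2 = {} \<or> A4 = {} \<or> s a + s b \<le> Min (s ` A4) then {a, b} else {a})
         else B' = {a}))"

text \<open>
  One round: \<open>C\<close> consists of the old buffer contents and the new item, \<open>B'\<close> is the new buffer.
\<close>

definition algorithm_round :: "real \<Rightarrow> (nat \<Rightarrow> real) \<Rightarrow> nat set \<Rightarrow> nat set \<Rightarrow> bool" where
  "algorithm_round R s C B' \<longleftrightarrow>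
     (let good = (\<lambda>X. X \<subseteq> C \<and> R / 2 \<le> sum s X \<and> sum s X \<le> 1);
          A1 = C \<inter> M1 R s; A2 = C \<inter> M2 R s; A3 = C \<inter> M3 R s; A4 = C \<inter> M4 R s
      in if \<exists>X. good X then good B'
         else \<exists>Ba Bb Bc Bd.
           step_a s A1 A2 A4 Ba \<and>
           add_min s A2 True Ba Bb \<and>
           add_min s A3 (A1 \<union> A2 = {} \<or> A4 = {}) Bb Bc \<and>
           add_min s A4 (card (Bc \<inter> (M1 R s \<union> M2 R s)) \<le> 2) Bc Bd \<and>
           B' = Bd \<union> (C \<inter> small R s))"

definition implements_algorithm ::
    "item list set \<Rightarrow> real \<Rightarrow> (item list \<Rightarrow> nat set) \<Rightarrow> bool" where
  "implements_algorithm P R alg \<longleftrightarrow>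
     alg [] = {} \<and>
     (\<forall>I e. I @ [e] \<in> P \<longrightarrow>
        algorithm_round R (\<lambda>i. isize ((I @ [e]) ! i)) (insert (length I) (alg I)) (alg (I @ [e])))"

end

theory Submission imports Defs
begin

text \<open>
  Put \<open>r = R / 2\<close>.  Once some subset of buffer and new item has size in \<open>[r, 1]\<close>, the ratio
  \<open>1 / r\<close> is reached and is never lost.  As long as there is none (\<open>nogood\<close>), every feasible subset
  of the buffer has size below \<open>r\<close>, so all small items fit on top of it, and only sets of
  medium items have to be compared.  Sizes near \<open>1\<close> are excluded among the items seen so far:
  two medium items of incompatible classes, or three of \<open>M1 \<union> M2\<close>, have total size above \<open>1\<close>
  even if some of them have been discarded (\<open>separated\<close>), because whatever was discarded is dominated
  by what is in the buffer (\<open>covers\<close>).  The feasible medium sets that remain have at most two items,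
  and for each of them the buffer holds a set that is at least \<open>r\<close> times as large.
\<close>

locale buffer_knapsack =
  fixes r :: real and s :: "nat \<Rightarrow> real"
  assumes r_pos: "0 < r" and r_sq: "1 / 2 < r\<^sup>2" and r_le: "r \<le> 3 / 4"
begin

abbreviation "sm \<equiv> small (2 * r) s"
abbreviation "m1 \<equiv> M1 (2 * r) s"
abbreviation "m2 \<equiv> M2 (2 * r) s"
abbreviation "m3 \<equiv> M3 (2 * r) s"
abbreviation "m4 \<equiv> M4 (2 * r) s"

definition nogood :: "nat set \<Rightarrow> bool" where
  "nogood C \<longleftrightarrow> (\<forall>X\<subseteq>C. sum s X \<le> 1 \<longrightarrow> sum s X < r)"

text \<open>
  The two disjunctions over \<open>m1\<close> and \<open>m4\<close> mirror the test \<open>s(a) + s(b) \<le> min A4\<close> of the algorithm: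
  in the presence of an \<open>M2\<close> item, either the pair \<open>a\<close>, \<open>b\<close> or the smallest \<open>M4\<close> item is kept,
  whichever is smaller, and it stands in for the other one.
\<close>

definition covers :: "nat set \<Rightarrow> nat set \<Rightarrow> bool" where
  "covers U B \<longleftrightarrow> B \<subseteq> U \<and> U \<inter> sm \<subseteq> B \<and> U \<inter> m2 \<subseteq> B \<and>
     (\<forall>x\<in>U \<inter> m1. \<exists>p\<in>B \<inter> m1. s p \<le> s x) \<and>
     (\<forall>x\<in>U \<inter> m1. \<forall>y\<in>U \<inter> m1. x \<noteq> y \<longrightarrow>
        (\<exists>p\<in>B \<inter> m1. \<exists>q\<in>B \<inter> m1. p \<noteq> q \<and> s p + s q \<le> s x + s y) \<or>
        (B \<inter> m2 \<noteq> {} \<and> (\<exists>d\<in>B \<inter> m4. s d < s x + s y))) \<and>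
     (\<forall>z\<in>U \<inter> m3. (\<exists>p\<in>B \<inter> m3. s p \<le> s z) \<or> (U \<inter> m2 \<noteq> {} \<and> U \<inter> m4 \<noteq> {})) \<and>
     (\<forall>d\<in>U \<inter> m4. (\<exists>p\<in>B \<inter> m4. s p \<le> s d) \<or>
        (B \<inter> m2 \<noteq> {} \<and> (\<exists>p\<in>B \<inter> m1. \<exists>q\<in>B \<inter> m1. p \<noteq> q \<and> s p + s q \<le> s d)))"

definition separated :: "nat set \<Rightarrow> bool" where
  "separated U \<longleftrightarrow> (\<forall>x\<in>U. s x < r) \<and>
     (\<forall>x\<in>U \<inter> m1. \<forall>d\<in>U \<inter> m4. 1 < s x + s d) \<and>
     (\<forall>c\<in>U \<inter> m2. \<forall>d\<in>U \<inter> m4. 1 < s c + s d) \<and>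
     (\<forall>c\<in>U \<inter> m2. \<forall>z\<in>U \<inter> m3. 1 < s c + s z) \<and>
     (\<forall>z\<in>U \<inter> m3. \<forall>z'\<in>U \<inter> m3. z \<noteq> z' \<longrightarrow> 1 < s z + s z') \<and>
     (\<forall>c\<in>U \<inter> m2. \<forall>c'\<in>U \<inter> m2. c = c') \<and>
     (\<forall>x\<in>U \<inter> m1. \<forall>z\<in>U \<inter> m3. \<exists>c\<in>U \<inter> m2. s c + s x < r) \<and>
     (\<forall>x\<in>U \<inter> m1. \<forall>y\<in>U \<inter> m1. x \<noteq> y \<longrightarrow> (\<forall>w\<in>U \<inter> m1. w \<noteq> x \<longrightarrow> w \<noteq> y \<longrightarrow> 1 < s x + s y + s w)) \<and>
     (\<forall>x\<in>U \<inter> m1. \<forall>y\<in>U \<inter> m1. x \<noteq> y \<longrightarrow> (\<forall>c\<in>U \<inter> m2. 1 < s x + s y + s c))"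

section \<open>Numerical bounds on \<open>r\<close> and the thresholds of the size classes\<close>

lemma r_gt: "7 / 10 < r"
proof (rule ccontr)
  assume "\<not> 7 / 10 < r"
  then have "r * r \<le> (7 / 10) * (7 / 10)" using r_pos by (intro mult_mono) auto
  with r_sq show False by (simp add: power2_eq_square)
qed

text \<open>Together with \<open>r_cube_le\<close> this relates the powers of \<open>r\<close>
  linearly, so that linear arithmetic can treat them as atoms.\<close>

lemma r_sq_le: "r\<^sup>2 \<le> 3 / 4 * r"
  using r_pos r_le by (simp add: power2_eq_square)

lemma r_cube_le: "r ^ 3 \<le> 3 / 4 * r\<^sup>2"
  using r_pos r_le by (simp add: power2_eq_square power3_eq_cube)

lemmas r_bounds = r_pos r_sq r_le r_gt r_sq_le

lemma class_iffs:
  "x \<in> sm \<longleftrightarrow> s x \<le> 1 - r"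
  "x \<in> m1 \<longleftrightarrow> 1 - r < s x \<and> s x < r / 2"
  "x \<in> m2 \<longleftrightarrow> r / 2 \<le> s x \<and> s x < 1 / 2"
  "x \<in> m3 \<longleftrightarrow> 1 / 2 \<le> s x \<and> s x < r\<^sup>2"
  "x \<in> m4 \<longleftrightarrow> r\<^sup>2 \<le> s x \<and> s x < r"
  by (auto simp: small_def M1_def M2_def M3_def M4_def power_mult_distrib)

section \<open>Pairs and triples of medium items without a good subset\<close>

lemma nogood_mono: "nogood C \<Longrightarrow> B \<subseteq> C \<Longrightarrow> nogood B"
  unfolding nogood_def by blast

lemma nogood_less: "nogood C \<Longrightarrow> x \<in> C \<Longrightarrow> s x \<le> 1 \<Longrightarrow> s x < r"
  unfolding nogood_def by (drule spec[of _ "{x}"]) auto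

lemma nogood_pair:
  "nogood C \<Longrightarrow> x \<in> C \<Longrightarrow> y \<in> C \<Longrightarrow> x \<noteq> y \<Longrightarrow> r \<le> s x + s y \<Longrightarrow> 1 < s x + s y"
  unfolding nogood_def by (drule spec[of _ "{x, y}"]) auto

lemma nogood_triple:
  "nogood C \<Longrightarrow> x \<in> C \<Longrightarrow> y \<in> C \<Longrightarrow> z \<in> C \<Longrightarrow> x \<noteq> y \<Longrightarrow> x \<noteq> z \<Longrightarrow> y \<noteq> z \<Longrightarrow>
    r \<le> s x + s y + s z \<Longrightarrow> 1 < s x + s y + s z"
  unfolding nogood_def by (drule spec[of _ "{x, y, z}"]) (auto simp: add.assoc)

context
  fixes C assumes ng: "nogood C"
begin

text \<open>The sum stays below \<open>r / 2 + 1 / 2 < 1\<close>, so the gap between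
  \<open>r\<close> and 1 forces it below \<open>r\<close>.\<close>

lemma nogood_12: "x \<in> C \<Longrightarrow> x \<in> m1 \<Longrightarrow> y \<in> C \<Longrightarrow> y \<in> m2 \<Longrightarrow> s x + s y < r"
  using nogood_pair[OF ng, of x y] r_bounds
  by (cases "x = y"; cases "s x + s y < r") (auto simp: class_iffs)

lemma nogood_22: "x \<in> C \<Longrightarrow> x \<in> m2 \<Longrightarrow> y \<in> C \<Longrightarrow> y \<in> m2 \<Longrightarrow> x = y"
  using nogood_pair[OF ng, of x y] r_bounds by (cases "x = y") (auto simp: class_iffs)

text \<open>The pair would be good: its sum exceeds \<open>3 / 2 - r\<close>, which is at least
  \<open>r\<close> because \<open>r \<le> 3 / 4\<close>, and stays below
  \<open>r / 2 + r\<^sup>2 < 1\<close>.\<close>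

lemma nogood_13: "x \<in> C \<Longrightarrow> x \<in> m1 \<Longrightarrow> y \<in> C \<Longrightarrow> y \<in> m3 \<Longrightarrow> False"
  using nogood_pair[OF ng, of x y] r_bounds by (cases "x = y") (auto simp: class_iffs)

lemma nogood_14: "x \<in> C \<Longrightarrow> x \<in> m1 \<Longrightarrow> y \<in> C \<Longrightarrow> y \<in> m4 \<Longrightarrow> 1 < s x + s y"
proof -
  assume a: "x \<in> C" "x \<in> m1" "y \<in> C" "y \<in> m4"
  \<comment> \<open>\<open>1 - r + r\<^sup>2\<close> is the lower bound on the sum of an M1 and an
    M4 item.\<close>
  have "0 \<le> (1 - r)\<^sup>2" by simp
  then have "r \<le> 1 - r + r\<^sup>2" by (simp add: power2_eq_square algebra_simps)
  then show ?thesis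
    using a nogood_pair[OF ng, of x y] r_bounds by (cases "x = y") (auto simp: class_iffs)
qed

lemma nogood_23: "x \<in> C \<Longrightarrow> x \<in> m2 \<Longrightarrow> y \<in> C \<Longrightarrow> y \<in> m3 \<Longrightarrow> 1 < s x + s y"
  using nogood_pair[OF ng, of x y] r_bounds by (cases "x = y") (auto simp: class_iffs)

lemma nogood_24: "x \<in> C \<Longrightarrow> x \<in> m2 \<Longrightarrow> y \<in> C \<Longrightarrow> y \<in> m4 \<Longrightarrow> 1 < s x + s y"
  using nogood_pair[OF ng, of x y] r_bounds by (cases "x = y") (auto simp: class_iffs)

lemma nogood_33: "x \<in> C \<Longrightarrow> x \<in> m3 \<Longrightarrow> y \<in> C \<Longrightarrow> y \<in> m3 \<Longrightarrow> x \<noteq> y \<Longrightarrow> 1 < s x + s y"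
  using nogood_pair[OF ng, of x y] r_bounds by (auto simp: class_iffs)

text \<open>Three M1 items total more than \<open>3 * (1 - r)\<close>, which reaches
  \<open>r\<close> precisely because \<open>r \<le> 3 / 4\<close>.\<close>

lemma nogood_111:
  "x \<in> C \<Longrightarrow> x \<in> m1 \<Longrightarrow> y \<in> C \<Longrightarrow> y \<in> m1 \<Longrightarrow> z \<in> C \<Longrightarrow> z \<in> m1 \<Longrightarrow>
    x \<noteq> y \<Longrightarrow> x \<noteq> z \<Longrightarrow> y \<noteq> z \<Longrightarrow> 1 < s x + s y + s z"
  using nogood_triple[OF ng, of x y z] r_bounds by (auto simp: class_iffs)

lemma nogood_112:
  "x \<in> C \<Longrightarrow> x \<in> m1 \<Longrightarrow> y \<in> C \<Longrightarrow> y \<in> m1 \<Longrightarrow> z \<in> C \<Longrightarrow> z \<in> m2 \<Longrightarrow>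
    x \<noteq> y \<Longrightarrow> 1 < s x + s y + s z"
  using nogood_triple[OF ng, of x y z] r_bounds
  by (cases "z = x \<or> z = y") (auto simp: class_iffs)

text \<open>Adding one small item, of size at most \<open>1 - r\<close>, to a set below
  \<open>r\<close> keeps it feasible, and then \<open>nogood\<close> puts it below \<open>r\<close>
  again.\<close>

lemma nogood_small:
  assumes Z: "Z \<subseteq> C" "sum s Z \<le> 1" "finite C" and F: "F \<subseteq> C \<inter> sm"
  shows "sum s (Z \<union> F) < r"
proof -
  have "finite F" using F Z(3) finite_subset by blast
  then show ?thesis using F
  proof (induction F rule: finite_induct)
    case empty
    then show ?case using Z ng by (auto simp: nogood_def)
  next
    case (insert x F)
    have IH: "sum s (Z \<union> F) < r" using insert by auto
    show ?case
    proof (cases "x \<in> Z \<union> F")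
      case True
      then show ?thesis using IH by (simp add: insert_absorb)
    next
      case False
      have "finite (Z \<union> F)" using Z(1,3) insert.hyps finite_subset by blast
      then have "sum s (insert x (Z \<union> F)) = s x + sum s (Z \<union> F)" using False by simp
      moreover have "s x \<le> 1 - r" using insert.prems by (auto simp: class_iffs)
      ultimately have "sum s (insert x (Z \<union> F)) \<le> 1" using IH by simp
      moreover have "insert x (Z \<union> F) \<subseteq> C" using insert.prems Z(1) by auto
      ultimately show ?thesis using ng unfolding nogood_def by auto
    qed
  qed
qed

end

section \<open>Representatives of discarded items, and separation of all items seen\<close>

lemma coversD:
  assumes "covers U B"
  shows "B \<subseteq> U" "x \<in> U \<Longrightarrow> x \<in> sm \<Longrightarrow> x \<in> B" "x \<in> U \<Longrightarrow> x \<in> m2 \<Longrightarrow> x \<in> B"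
    "x \<in> U \<Longrightarrow> x \<in> m1 \<Longrightarrow> \<exists>p\<in>B \<inter> m1. s p \<le> s x"
    "x \<in> U \<Longrightarrow> x \<in> m1 \<Longrightarrow> y \<in> U \<Longrightarrow> y \<in> m1 \<Longrightarrow> x \<noteq> y \<Longrightarrow>
        (\<exists>p\<in>B \<inter> m1. \<exists>q\<in>B \<inter> m1. p \<noteq> q \<and> s p + s q \<le> s x + s y) \<or>
        (B \<inter> m2 \<noteq> {} \<and> (\<exists>d\<in>B \<inter> m4. s d < s x + s y))"
    "x \<in> U \<Longrightarrow> x \<in> m3 \<Longrightarrow> (\<exists>p\<in>B \<inter> m3. s p \<le> s x) \<or> (U \<inter> m2 \<noteq> {} \<and> U \<inter> m4 \<noteq> {})"
    "x \<in> U \<Longrightarrow> x \<in> m4 \<Longrightarrow> (\<exists>p\<in>B \<inter> m4. s p \<le> s x) \<or>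
        (B \<inter> m2 \<noteq> {} \<and> (\<exists>p\<in>B \<inter> m1. \<exists>q\<in>B \<inter> m1. p \<noteq> q \<and> s p + s q \<le> s x))"
  using assms unfolding covers_def by simp_all blast+

text \<open>Only M1 pairs containing the new item need an argument: the other member is exchanged
  for its representative, which differs from \<open>e\<close> because \<open>e\<close> is
  new.\<close>

lemma covers_insert:
  assumes "covers U B" "e \<notin> U" shows "covers (insert e U) (insert e B)"
proof -
  note c = coversD[OF assms(1)]
  have new: "\<exists>p\<in>insert e B \<inter> m1. \<exists>q\<in>insert e B \<inter> m1. p \<noteq> q \<and> s p + s q \<le> s e + s y"
    if y: "y \<in> U" "y \<in> m1" and e: "e \<in> m1" for y
  proof -
    obtain p where "p \<in> B \<inter> m1" "s p \<le> s y" using c(4) y by blast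
    then show ?thesis using e c(1) assms(2) by (intro bexI[of _ e] bexI[of _ p]) auto
  qed
  show ?thesis
    unfolding covers_def
  proof (intro conjI ballI impI, goal_cases)
    case (5 x y)
    consider "x = e" | "y = e" | "x \<in> U" "y \<in> U" using 5 by blast
    then show ?case
    proof cases
      case 1 then show ?thesis using 5 new[of y] by auto
    next
      case 2 then show ?thesis using 5 new[of x] by (auto simp: add.commute)
    next
      case 3 then show ?thesis using c(5)[of x y] 5 by blast
    qed
  next
    case (6 z) then show ?case using c(6)[of z] by blast
  next
    case (7 d) then show ?case using c(7)[of d] by blast
  next
    case (4 x) then show ?case using c(4)[of x] by blast
  qed (use c in blast)+
qed

text \<open>A round first adds the item and then discards, so two coverings must compose. A pair may
  be represented by an M4 item and that item in turn by a pair; both alternatives are closed under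
  such changes, since sizes never grow.\<close>

lemma covers_trans:
  assumes "covers U C" "covers C B" shows "covers U B"
proof -
  note u = coversD[OF assms(1)] and c = coversD[OF assms(2)]
  have m2: "B \<inter> m2 \<noteq> {}" if "C \<inter> m2 \<noteq> {}" using that c(3) by blast
  show ?thesis
    unfolding covers_def
  proof (intro conjI ballI impI, goal_cases)
    case (4 x) then show ?case using u(4)[of x] c(4) by (meson IntE order_trans)
  next
    case (5 x y)
    then consider (a) p q where "p \<in> C \<inter> m1" "q \<in> C \<inter> m1" "p \<noteq> q" "s p + s q \<le> s x + s y"
      | (b) d where "C \<inter> m2 \<noteq> {}" "d \<in> C \<inter> m4" "s d < s x + s y"
      using u(5)[of x y] by blast
    then show ?case
    proof cases
      case a
      then show ?thesis using c(5)[of p q] by (smt (verit) IntE)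
    next
      case b
      then show ?thesis using c(7)[of d] m2 by (smt (verit) IntE)
    qed
  next
    case (6 z)
    then show ?case using u(6)[of z] u(1) c(6) by (smt (verit, del_insts) IntE IntI disjoint_iff subsetD)
  next
    case (7 d)
    then consider (a) d' where "d' \<in> C \<inter> m4" "s d' \<le> s d"
      | (b) p q where "C \<inter> m2 \<noteq> {}" "p \<in> C \<inter> m1" "q \<in> C \<inter> m1" "p \<noteq> q" "s p + s q \<le> s d"
      using u(7)[of d] by blast
    then show ?case
    proof cases
      case a
      then show ?thesis using c(7)[of d'] by (smt (verit) IntE)
    next
      case b
      then show ?thesis using c(5)[of p q] m2 by (smt (verit) IntE)
    qed
  qed (use u c in blast)+
qed

lemma separatedD:
  assumes "separated U"
  shows "x \<in> U \<Longrightarrow> s x < r"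
    "x \<in> U \<Longrightarrow> x \<in> m1 \<Longrightarrow> y \<in> U \<Longrightarrow> y \<in> m4 \<Longrightarrow> 1 < s x + s y"
    "x \<in> U \<Longrightarrow> x \<in> m2 \<Longrightarrow> y \<in> U \<Longrightarrow> y \<in> m4 \<Longrightarrow> 1 < s x + s y"
    "x \<in> U \<Longrightarrow> x \<in> m2 \<Longrightarrow> y \<in> U \<Longrightarrow> y \<in> m3 \<Longrightarrow> 1 < s x + s y"
    "x \<in> U \<Longrightarrow> x \<in> m3 \<Longrightarrow> y \<in> U \<Longrightarrow> y \<in> m3 \<Longrightarrow> x \<noteq> y \<Longrightarrow> 1 < s x + s y"
    "x \<in> U \<Longrightarrow> x \<in> m2 \<Longrightarrow> y \<in> U \<Longrightarrow> y \<in> m2 \<Longrightarrow> x = y"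
    "x \<in> U \<Longrightarrow> x \<in> m1 \<Longrightarrow> y \<in> U \<Longrightarrow> y \<in> m3 \<Longrightarrow> \<exists>c\<in>U \<inter> m2. s c + s x < r"
    "x \<in> U \<Longrightarrow> x \<in> m1 \<Longrightarrow> y \<in> U \<Longrightarrow> y \<in> m1 \<Longrightarrow> z \<in> U \<Longrightarrow> z \<in> m1 \<Longrightarrow>
      x \<noteq> y \<Longrightarrow> x \<noteq> z \<Longrightarrow> y \<noteq> z \<Longrightarrow> 1 < s x + s y + s z"
    "x \<in> U \<Longrightarrow> x \<in> m1 \<Longrightarrow> y \<in> U \<Longrightarrow> y \<in> m1 \<Longrightarrow> z \<in> U \<Longrightarrow> z \<in> m2 \<Longrightarrow>
      x \<noteq> y \<Longrightarrow> 1 < s x + s y + s z"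
  using assms unfolding separated_def by simp_all blast+

text \<open>Each old partner of \<open>e\<close> is replaced by a representative in the buffer that
  is no larger, and \<open>nogood\<close> applies to that one. Where the representative has another
  class, the matching exclusion is used: a triple of M1 items in place of M1 with M4, and
  conversely.\<close>

lemma separated_insert:
  assumes cov: "covers U B" and sep: "separated U" and "e \<notin> U" "s e \<le> 1"
    and ng: "nogood (insert e B)"
  shows "separated (insert e U)"
proof -
  note c = coversD[OF cov] and p = separatedD[OF sep]
  have eB: "e \<notin> B" using c(1) \<open>e \<notin> U\<close> by blast
  have m22: False if h: "e \<in> m2" "x \<in> U" "x \<in> m2" for x
    using nogood_22[OF ng, of e x] c(3)[of x] h eB by auto
  have e14: "1 < s e + s d" if h: "e \<in> m1" "d \<in> U" "d \<in> m4" for d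
  proof -
    consider (a) d' where "d' \<in> B" "d' \<in> m4" "s d' \<le> s d"
      | (b) p q where "p \<in> B" "p \<in> m1" "q \<in> B" "q \<in> m1" "p \<noteq> q" "s p + s q \<le> s d"
      using c(7)[of d] h by blast
    then show ?thesis
    proof cases
      case a then show ?thesis using nogood_14[OF ng, of e d'] h by auto
    next
      case b then show ?thesis using nogood_111[OF ng, of e p q] h eB by force
    qed
  qed
  have e41: "1 < s x + s e" if h: "e \<in> m4" "x \<in> U" "x \<in> m1" for x
    using c(4)[of x] h nogood_14[OF ng, of _ e] by force
  have e24: "1 < s e + s d" if h: "e \<in> m2" "d \<in> U" "d \<in> m4" for d
  proof -
    consider (a) d' where "d' \<in> B" "d' \<in> m4" "s d' \<le> s d" | (b) x where "x \<in> B" "x \<in> m2"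
      using c(7)[of d] h by blast
    then show ?thesis
    proof cases
      case a then show ?thesis using nogood_24[OF ng, of e d'] h by auto
    next
      \<comment> \<open>An M4 item is represented by a pair only next to an M2 item, which would be
        a second one besides \<open>e\<close>.\<close>
      case b then show ?thesis using m22 c(1) h by blast
    qed
  qed
  have e42: "1 < s x + s e" if h: "e \<in> m4" "x \<in> U" "x \<in> m2" for x
    using c(3)[of x] h nogood_24[OF ng, of x e] by auto
  have e23: "1 < s e + s z" if h: "e \<in> m2" "z \<in> U" "z \<in> m3" for z
  proof -
    consider (a) z' where "z' \<in> B" "z' \<in> m3" "s z' \<le> s z" | (b) x where "x \<in> U" "x \<in> m2"
      using c(6)[of z] h by blast
    then show ?thesis
    proof cases
      case a then show ?thesis using nogood_23[OF ng, of e z'] h by auto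
    next
      case b then show ?thesis using m22 h by blast
    qed
  qed
  have e32: "1 < s x + s e" if h: "e \<in> m3" "x \<in> U" "x \<in> m2" for x
    using c(3)[of x] h nogood_23[OF ng, of x e] by auto
  have e33: "1 < s e + s z" if h: "e \<in> m3" "z \<in> U" "z \<in> m3" for z
  proof -
    consider (a) z' where "z' \<in> B" "z' \<in> m3" "s z' \<le> s z" | (b) x where "x \<in> U" "x \<in> m2"
      using c(6)[of z] h by blast
    then show ?thesis
    proof cases
      case a then show ?thesis using nogood_33[OF ng, of e z'] h eB by force
    next
      \<comment> \<open>The M2 item is below \<open>1 / 2\<close>, so \<open>e\<close> exceeds
        \<open>1 / 2\<close>, while \<open>z\<close> is at least \<open>1 / 2\<close>.\<close>
      case b then show ?thesis using e32[of x] h by (auto simp: class_iffs)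
    qed
  qed
  \<comment> \<open>An M3 item still in the buffer would form a good pair with \<open>e\<close>. So
    it was dropped in the presence of an M2 item, which is still there and stays below
    \<open>r\<close> together with \<open>e\<close>.\<close>
  have e13: "\<exists>c\<in>insert e U \<inter> m2. s c + s e < r" if h: "e \<in> m1" "z \<in> U" "z \<in> m3" for z
  proof -
    consider (a) z' where "z' \<in> B" "z' \<in> m3" | (b) x where "x \<in> U" "x \<in> m2"
      using c(6)[of z] h by blast
    then show ?thesis
    proof cases
      case a then show ?thesis using nogood_13[OF ng, of e z'] h by auto
    next
      case b
      then have "s e + s x < r" using nogood_12[OF ng, of e x] c(3)[of x] h by auto
      then show ?thesis using b by (auto simp: add.commute)
    qed
  qed
  have e31: False if h: "e \<in> m3" "x \<in> U" "x \<in> m1" for x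
    using c(4)[of x] h nogood_13[OF ng, of _ e] by blast
  have e111: "1 < s e + s x + s y" if h: "e \<in> m1" "x \<in> U" "x \<in> m1" "y \<in> U" "y \<in> m1" "x \<noteq> y" for x y
  proof -
    consider (a) p q where "p \<in> B" "p \<in> m1" "q \<in> B" "q \<in> m1" "p \<noteq> q" "s p + s q \<le> s x + s y"
      | (b) d where "d \<in> B" "d \<in> m4" "s d < s x + s y"
      using c(5)[of x y] h by blast
    then show ?thesis
    proof cases
      case a then show ?thesis using nogood_111[OF ng, of e p q] h eB by force
    next
      case b then show ?thesis using nogood_14[OF ng, of e d] h by auto
    qed
  qed
  have e112: "1 < s e + s x + s y" if h: "e \<in> m1" "x \<in> U" "x \<in> m1" "y \<in> U" "y \<in> m2" for x y
  proof -
    obtain p where "p \<in> B" "p \<in> m1" "s p \<le> s x" using c(4)[of x] h by blast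
    then show ?thesis using nogood_112[OF ng, of e p y] c(3)[of y] h eB by force
  qed
  have e211: "1 < s x + s y + s e" if h: "e \<in> m2" "x \<in> U" "x \<in> m1" "y \<in> U" "y \<in> m1" "x \<noteq> y" for x y
  proof -
    consider (a) p q where "p \<in> B" "p \<in> m1" "q \<in> B" "q \<in> m1" "p \<noteq> q" "s p + s q \<le> s x + s y"
      | (b) x where "x \<in> B" "x \<in> m2"
      using c(5)[of x y] h by blast
    then show ?thesis
    proof cases
      case a then show ?thesis using nogood_112[OF ng, of p q e] h by auto
    next
      case b then show ?thesis using m22 c(1) h by blast
    qed
  qed
  have disj: "\<not> (x \<in> m1 \<and> x \<in> m2)" "\<not> (x \<in> m1 \<and> x \<in> m3)" "\<not> (x \<in> m1 \<and> x \<in> m4)"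
    "\<not> (x \<in> m2 \<and> x \<in> m3)" "\<not> (x \<in> m2 \<and> x \<in> m4)" for x
    using r_bounds by (auto simp: class_iffs)
  show ?thesis
    unfolding separated_def
  proof (intro conjI ballI impI, goal_cases)
    case (1 x) then show ?case using p(1) nogood_less[OF ng, of e] assms(4) by auto
  next
    case (2 x d) then show ?case using p(2) e14 e41 disj by blast
  next
    case (3 x d) then show ?case using p(3) e24 e42 disj by blast
  next
    case (4 x d) then show ?case using p(4) e23 e32 disj by blast
  next
    case (5 x y)
    consider "x = e" | "y = e" | "x \<in> U" "y \<in> U" using 5 by blast
    then show ?case using 5 p(5)[of x y] e33[of x] e33[of y] by cases (auto simp: add.commute)
  next
    case (6 x y) then show ?case using p(6) m22 by blast
  next
    case (7 x z) then show ?case using p(7)[of x z] e13[of z] e31[of x] disj by blast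
  next
    case (8 x y w)
    consider "x = e" | "y = e" | "w = e" | "x \<in> U" "y \<in> U" "w \<in> U" using 8 by blast
    then show ?case
    proof cases
      case 1 then show ?thesis using 8 e111[of y w] by auto
    next
      case 2 then show ?thesis using 8 e111[of x w] by auto
    next
      case 3 then show ?thesis using 8 e111[of x y] by auto
    next
      case 4 then show ?thesis using 8 p(8)[of x y w] by auto
    qed
  next
    case (9 x y w)
    consider "x = e" | "y = e" | "w = e" | "x \<in> U" "y \<in> U" "w \<in> U" using 9 by blast
    then show ?case
    proof cases
      case 1 then show ?thesis using 9 e112[of y w] disj by auto
    next
      case 2 then show ?thesis using 9 e112[of x w] disj by auto
    next
      case 3 then show ?thesis using 9 e211[of x y] disj by auto
    next
      case 4 then show ?thesis using 9 p(9)[of x y w] by auto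
    qed
  qed
qed

end

section \<open>The round relation: unfolding and totality\<close>

lemma min_item_iff: "min_item s A x \<longleftrightarrow> x \<in> A \<and> (\<forall>y\<in>A. s x \<le> s y)"
  unfolding min_item_def is_arg_min_def by (auto simp: not_less)

lemma step_a_cases:
  assumes "step_a s A1 A2 A4 B'"
  shows "A1 = {} \<and> B' = {} \<or> (\<exists>a. min_item s A1 a \<and>
    (B' = {a} \<or> (\<exists>b. min_item s (A1 - {a}) b \<and> B' = {a, b})))"
  using assms unfolding step_a_def by (simp split: if_splits) metis+

lemma add_min_cases:
  assumes "add_min s A c B B'"
  shows "B' = B \<and> (A = {} \<or> \<not> c) \<or> (\<exists>x. min_item s A x \<and> B' = insert x B \<and> c)"
  using assms unfolding add_min_def by (auto split: if_splits)

lemma algorithm_roundE: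
  assumes "algorithm_round R s C B'" "\<not> (\<exists>X. X \<subseteq> C \<and> R / 2 \<le> sum s X \<and> sum s X \<le> 1)"
  obtains Ba Bb Bc Bd where
    "step_a s (C \<inter> M1 R s) (C \<inter> M2 R s) (C \<inter> M4 R s) Ba"
    "add_min s (C \<inter> M2 R s) True Ba Bb"
    "add_min s (C \<inter> M3 R s) (C \<inter> M1 R s \<union> C \<inter> M2 R s = {} \<or> C \<inter> M4 R s = {}) Bb Bc"
    "add_min s (C \<inter> M4 R s) (card (Bc \<inter> (M1 R s \<union> M2 R s)) \<le> 2) Bc Bd"
    "B' = Bd \<union> (C \<inter> small R s)"
  using assms(1) unfolding algorithm_round_def Let_def if_not_P[OF assms(2)] by blast

lemma algorithm_round_subset:
  assumes "algorithm_round R s C B'" shows "B' \<subseteq> C"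
proof -
  have am: "B' \<subseteq> B \<union> A" if "add_min s A c B B'" for A c B B'
    using add_min_cases[OF that] unfolding min_item_iff by blast
  have sa: "B' \<subseteq> A1" if "step_a s A1 A2 A4 B'" for A1 A2 A4 B'
    using step_a_cases[OF that] unfolding min_item_iff by blast
  show ?thesis
  proof (cases "\<exists>X. X \<subseteq> C \<and> R / 2 \<le> sum s X \<and> sum s X \<le> 1")
    case True
    then show ?thesis using assms unfolding algorithm_round_def Let_def by auto
  next
    case False
    from algorithm_roundE[OF assms False] show ?thesis
      using sa am by (smt (verit) Un_subset_iff inf.cobounded1 order_trans)
  qed
qed

lemma ex_min_item:
  assumes "finite A" "A \<noteq> {}" shows "\<exists>x. min_item s A x"
  unfolding min_item_def using ex_is_arg_min_if_finite[OF assms, of s] by simp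

text \<open>Every minimum is taken over a finite nonempty set, so no round gets stuck. This is what
  the existence half of the theorem rests on.\<close>

lemma ex_algorithm_round:
  assumes "finite C" shows "\<exists>B'. algorithm_round R s C B'"
proof -
  have am: "\<exists>B'. add_min s (C \<inter> M) c B B'" for M c B
    unfolding add_min_def using ex_min_item[of "C \<inter> M" s] assms by auto
  have sa: "\<exists>B'. step_a s (C \<inter> M) A2 A4 B'" for M A2 A4
  proof (cases "C \<inter> M = {}")
    case False
    then obtain a where a: "min_item s (C \<inter> M) a" using ex_min_item[of "C \<inter> M" s] assms by auto
    show ?thesis
    proof (cases "card (C \<inter> M) \<ge> 2")
      case True
      have "C \<inter> M - {a} \<noteq> {}"
      proof
        assume "C \<inter> M - {a} = {}"
        then have "card (C \<inter> M) \<le> card {a}" by (intro card_mono) auto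
        with True show False by simp
      qed
      then obtain b where "min_item s (C \<inter> M - {a}) b"
        using ex_min_item[of "C \<inter> M - {a}" s] assms by auto
      with a True False show ?thesis
        unfolding step_a_def if_not_P[OF False] if_P[OF True] by blast
    qed (use a False in \<open>auto simp: step_a_def\<close>)
  qed (auto simp: step_a_def)
  show ?thesis
  proof (cases "\<exists>X. X \<subseteq> C \<and> R / 2 \<le> sum s X \<and> sum s X \<le> 1")
    case True
    then show ?thesis unfolding algorithm_round_def Let_def by auto
  next
    case False
    obtain Ba where "step_a s (C \<inter> M1 R s) (C \<inter> M2 R s) (C \<inter> M4 R s) Ba" using sa by blast
    moreover obtain Bb where "add_min s (C \<inter> M2 R s) True Ba Bb" using am by blast
    moreover obtain Bc where
      "add_min s (C \<inter> M3 R s) (C \<inter> M1 R s \<union> C \<inter> M2 R s = {} \<or> C \<inter> M4 R s = {}) Bb Bc"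
      using am by blast
    moreover obtain Bd where
      "add_min s (C \<inter> M4 R s) (card (Bc \<inter> (M1 R s \<union> M2 R s)) \<le> 2) Bc Bd" using am by blast
    ultimately show ?thesis using False unfolding algorithm_round_def Let_def by metis
  qed
qed

section \<open>Covering and capacity after a single round\<close>

context buffer_knapsack
begin

text \<open>The feasible set \<open>G\<close> and all small items together stay below
  \<open>r\<close>, and so does the one extra item \<open>x\<close>; this is where the capacity
  \<open>R = 2 * r\<close> comes from.\<close>

lemma total_size_bound:
  assumes ng: "nogood C" and fin: "finite C" and pos: "\<And>e. e \<in> C \<Longrightarrow> 0 < s e \<and> s e \<le> 1"
    and G: "G \<subseteq> C" "sum s G \<le> 1" and x: "x \<in> C"
    and B: "B \<subseteq> insert x (G \<union> (C \<inter> sm))"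
  shows "sum s B \<le> 2 * r"
proof -
  let ?D = "G \<union> (C \<inter> sm)"
  have D: "?D \<subseteq> C" using G by auto
  then have fD: "finite ?D" using fin finite_subset by blast
  have "sum s B \<le> sum s (insert x ?D)"
    using B fD D x pos by (intro sum_mono2) (auto intro: less_imp_le)
  also have "\<dots> \<le> s x + sum s ?D"
    using fD pos[OF x] by (cases "x \<in> ?D") (auto simp: insert_absorb)
  also have "\<dots> \<le> r + r"
    using nogood_small[OF ng G fin order_refl] nogood_less[OF ng x] pos[OF x] by simp
  finally show ?thesis by simp
qed

text \<open>Without a good subset there is at most one M2 item, and no M1 item next to an M3 item,
  which leaves few shapes for the new buffer. In each of them, removing at most one item and the
  small ones leaves a feasible set.\<close>

lemma round_step:
  assumes ng: "nogood C" and fin: "finite C" and pos: "\<And>e. e \<in> C \<Longrightarrow> 0 < s e \<and> s e \<le> 1"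
    and rnd: "algorithm_round (2 * r) s C B'"
  shows "covers C B' \<and> sum s B' \<le> 2 * r"
proof -
  have no: "\<not> (\<exists>X. X \<subseteq> C \<and> 2 * r / 2 \<le> sum s X \<and> sum s X \<le> 1)"
    using ng unfolding nogood_def by (auto simp: not_le[symmetric])
  obtain Ba Bb Bc Bd where
    a: "step_a s (C \<inter> m1) (C \<inter> m2) (C \<inter> m4) Ba" and
    b: "add_min s (C \<inter> m2) True Ba Bb" and
    c: "add_min s (C \<inter> m3) (C \<inter> m1 \<union> C \<inter> m2 = {} \<or> C \<inter> m4 = {}) Bb Bc" and
    d: "add_min s (C \<inter> m4) (card (Bc \<inter> (m1 \<union> m2)) \<le> 2) Bc Bd" and
    B': "B' = Bd \<union> (C \<inter> sm)"
    by (rule algorithm_roundE[OF rnd no])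
  have disj: "\<not> (x \<in> m1 \<and> x \<in> m2)" "\<not> (x \<in> m1 \<and> x \<in> m3)" "\<not> (x \<in> m1 \<and> x \<in> m4)"
    "\<not> (x \<in> m2 \<and> x \<in> m3)" "\<not> (x \<in> m2 \<and> x \<in> m4)" "\<not> (x \<in> m3 \<and> x \<in> m4)" for x
    using r_bounds by (auto simp: class_iffs)
  note a_cases = step_a_cases[OF a] and b_cases = add_min_cases[OF b]
    and c_cases = add_min_cases[OF c] and d_cases = add_min_cases[OF d]
  have sub_a: "Ba \<subseteq> C \<inter> m1" using a_cases unfolding min_item_iff by blast
  have min_a: "\<exists>p\<in>Ba. s p \<le> s x" if "x \<in> C" "x \<in> m1" for x
    using a_cases that unfolding min_item_iff by blast
  have card_a: "card Ba \<le> 2" using a_cases by (auto simp: card_insert_if)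
  have Min4: "\<exists>e\<in>C \<inter> m4. s e = Min (s ` (C \<inter> m4))" if "C \<inter> m4 \<noteq> {}"
  proof -
    have "Min (s ` (C \<inter> m4)) \<in> s ` (C \<inter> m4)" using that fin by (intro Min_in) auto
    then obtain e where "Min (s ` (C \<inter> m4)) = s e" "e \<in> C \<inter> m4" by (rule imageE)
    then show ?thesis by (intro bexI[of _ e]) simp_all
  qed
  have Min4_le: "Min (s ` (C \<inter> m4)) \<le> s e" if "e \<in> C" "e \<in> m4" for e
    using that fin by auto
  \<comment> \<open>The second alternative is a failed test in step (a). Only one M1 item is kept
    then, so step (d) has room for the smallest M4 item.\<close>
  have pair_a: "(\<exists>p\<in>Ba. \<exists>q\<in>Ba. p \<noteq> q \<and> s p + s q \<le> s x + s y) \<or>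
      (C \<inter> m2 \<noteq> {} \<and> C \<inter> m4 \<noteq> {} \<and> Min (s ` (C \<inter> m4)) < s x + s y \<and> card Ba \<le> 1)"
    if xy: "x \<in> C" "x \<in> m1" "y \<in> C" "y \<in> m1" "x \<noteq> y" for x y
  proof -
    have "card {x, y} \<le> card (C \<inter> m1)" using xy fin by (intro card_mono) auto
    then have card: "2 \<le> card (C \<inter> m1)" using xy by simp
    have ne: "C \<inter> m1 \<noteq> {}" using xy by auto
    obtain p q where p: "min_item s (C \<inter> m1) p" and q: "min_item s (C \<inter> m1 - {p}) q"
      and Ba: "Ba = (if C \<inter> m2 = {} \<or> C \<inter> m4 = {} \<or> s p + s q \<le> Min (s ` (C \<inter> m4))
        then {p, q} else {p})"
      using a unfolding step_a_def if_not_P[OF ne] if_P[OF card] by blast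
    have pm: "s p \<le> s e" if "e \<in> C \<inter> m1" for e
      using p that unfolding min_item_iff by blast
    have qm: "s q \<le> s e" if "e \<in> C \<inter> m1" "e \<noteq> p" for e
      using q that unfolding min_item_iff by blast
    have "p \<noteq> q" using q unfolding min_item_iff by auto
    moreover have "s p + s q \<le> s x + s y"
      using pm[of x] pm[of y] qm[of x] qm[of y] xy by (cases "x = p") auto
    ultimately show ?thesis using Ba by auto
  qed
  \<comment> \<open>Conversely, two M1 items kept beside an M2 item have passed the test, so they
    can stand in for every M4 item.\<close>
  have cond_a: "(\<exists>p\<in>Ba. \<exists>q\<in>Ba. p \<noteq> q \<and> s p + s q \<le> s e)"
    if "card Ba > 1" "C \<inter> m2 \<noteq> {}" "e \<in> C" "e \<in> m4" for e
  proof -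
    have "Ba \<noteq> {}" using that(1) by auto
    then have ne: "C \<inter> m1 \<noteq> {}" using sub_a by blast
    have card: "2 \<le> card (C \<inter> m1)"
      using that(1) sub_a fin card_mono[of "C \<inter> m1" Ba] by auto
    obtain p q where "min_item s (C \<inter> m1 - {p}) q"
      and Ba: "Ba = (if C \<inter> m2 = {} \<or> C \<inter> m4 = {} \<or> s p + s q \<le> Min (s ` (C \<inter> m4))
        then {p, q} else {p})"
      using a unfolding step_a_def if_not_P[OF ne] if_P[OF card] by blast
    moreover from this(1) have "p \<noteq> q" unfolding min_item_iff by auto
    ultimately show ?thesis using that Min4_le[of e] by (auto split: if_splits)
  qed
  \<comment> \<open>The M2 item is unique, so adding a minimum adds the whole class.\<close>
  have Bb: "Bb = Ba \<union> (C \<inter> m2)"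
    using b_cases nogood_22[OF ng] unfolding min_item_iff by blast
  have card_m2: "card (C \<inter> m2) \<le> 1"
  proof -
    have "\<forall>x\<in>C \<inter> m2. \<forall>y\<in>C \<inter> m2. x = y" using nogood_22[OF ng] by blast
    then show ?thesis using card_le_Suc0_iff_eq[of "C \<inter> m2"] fin by simp
  qed
  have sub_b: "Bb \<subseteq> C \<inter> (m1 \<union> m2)" using Bb sub_a by auto
  have sub_c: "Bb \<subseteq> Bc" "Bc \<subseteq> Bb \<union> (C \<inter> m3)"
    using c_cases unfolding min_item_iff by blast+
  have sub_d: "Bc \<subseteq> Bd" "Bd \<subseteq> Bc \<union> (C \<inter> m4)"
    using d_cases unfolding min_item_iff by blast+
  \<comment> \<open>The count in step (d) is thus unaffected by step (c).\<close>
  have Bc_med: "Bc \<inter> (m1 \<union> m2) = Bb" using sub_c sub_b disj by blast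
  have min_d: "\<exists>p\<in>Bd \<inter> m4. s p \<le> s e" if "e \<in> C" "e \<in> m4" "card Bb \<le> 2" for e
    using d_cases that unfolding Bc_med min_item_iff by blast
  have min_c: "\<exists>p\<in>Bc \<inter> m3. s p \<le> s e" if "e \<in> C" "e \<in> m3" "C \<inter> m1 \<union> C \<inter> m2 = {} \<or> C \<inter> m4 = {}" for e
    using c_cases that unfolding min_item_iff by blast
  have fin_a: "finite Ba" using sub_a fin finite_subset by blast
  have card_b: "card Bb \<le> card Ba + card (C \<inter> m2)" unfolding Bb by (rule card_Un_le)
  have in4: "(\<exists>p\<in>B' \<inter> m4. s p \<le> s e) \<or>
      (C \<inter> m2 \<noteq> {} \<and> (\<exists>p\<in>Ba. \<exists>q\<in>Ba. p \<noteq> q \<and> s p + s q \<le> s e))"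
    if "e \<in> C" "e \<in> m4" for e
  proof (cases "card Bb \<le> 2")
    case True
    then show ?thesis using min_d[OF that] B' by blast
  next
    case False
    then have "card Ba > 1" "C \<inter> m2 \<noteq> {}" using card_b card_m2 card_a by auto
    then show ?thesis using cond_a that by blast
  qed
  have Ba_B': "Ba \<subseteq> B' \<inter> m1" using sub_a Bb sub_c sub_d B' by blast
  have m2_B': "C \<inter> m2 \<subseteq> B' \<inter> m2" using Bb sub_c sub_d B' by blast
  have "covers C B'"
    unfolding covers_def
  proof (intro conjI ballI impI, goal_cases)
    case 1 then show ?case using B' sub_d sub_c sub_b by blast
  next
    case 2 then show ?case using B' by blast
  next
    case 3 then show ?case using m2_B' by blast
  next
    case (4 x) then show ?case using min_a[of x] Ba_B' by blast
  next
    case (5 x y)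
    then consider (a) "\<exists>p\<in>Ba. \<exists>q\<in>Ba. p \<noteq> q \<and> s p + s q \<le> s x + s y"
      | (b) "C \<inter> m2 \<noteq> {}" "C \<inter> m4 \<noteq> {}" "Min (s ` (C \<inter> m4)) < s x + s y" "card Ba \<le> 1"
      using pair_a[of x y] by blast
    then show ?case
    proof cases
      case a then show ?thesis using Ba_B' by blast
    next
      case b
      obtain e where e: "e \<in> C" "e \<in> m4" "s e = Min (s ` (C \<inter> m4))" using Min4 b by blast
      have "card Bb \<le> 2" using b card_b card_m2 by simp
      then obtain p where "p \<in> Bd \<inter> m4" "s p \<le> s e" using min_d e by blast
      then have "p \<in> B' \<inter> m4" "s p < s x + s y" using B' b e by auto
      then show ?thesis using b m2_B' by blast
    qed
  next
    case (6 z)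
    \<comment> \<open>Hence step (c) is skipped only if M2 and M4 items are both present, the
      exception that \<open>covers\<close> grants for M3.\<close>
    then have "C \<inter> m1 = {}" using nogood_13[OF ng] by blast
    then show ?case using min_c[of z] 6 B' sub_d by blast
  next
    case (7 e) then show ?case using in4[of e] Ba_B' m2_B' by blast
  qed
  moreover have "sum s B' \<le> 2 * r"
  proof (cases "B' = {}")
    case False
    then obtain x0 where x0: "x0 \<in> C" using \<open>covers C B'\<close> coversD(1) by blast
    have half: "s x < 1 / 2" if "x \<in> Bb" for x
      using that sub_b r_bounds by (auto simp: class_iffs)
    have sum_b: "sum s Bb \<le> 1" if "card Bb \<le> 2"
    proof -
      have "sum s Bb \<le> real (card Bb) * (1 / 2)"
        using half by (intro sum_bounded_above) (auto intro: less_imp_le)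
      then show ?thesis using that by simp
    qed
    note bound = total_size_bound[OF ng fin pos]
    have Bc_cases: "Bc = Bb \<or> (\<exists>z. z \<in> C \<inter> m3 \<and> Bc = insert z Bb \<and> (C \<inter> m1 \<union> C \<inter> m2 = {} \<or> C \<inter> m4 = {}))"
      using c_cases unfolding min_item_iff by blast+
    have Bd_cases: "Bd = Bc \<or> (\<exists>x. x \<in> C \<inter> m4 \<and> Bd = insert x Bc \<and> card Bb \<le> 2)"
      using d_cases unfolding Bc_med min_item_iff by blast
    show ?thesis
    proof (cases "card Bb \<le> 2")
      case True
      have Bb_bound: ?thesis if "x \<in> C" "Bd \<subseteq> insert x Bb" for x
        using bound[of Bb x B'] sum_b[OF True] sub_b that B' by blast
      \<comment> \<open>An M3 and an M4 item are added together only if there are no M1 and M2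
        items; then the M3 item alone is the feasible part.\<close>
      consider "Bd = Bb" | x where "x \<in> C" "Bd = insert x Bb"
        | x z where "x \<in> C \<inter> m4" "z \<in> C \<inter> m3" "Bd = insert x (insert z Bb)" "C \<inter> m1 \<union> C \<inter> m2 = {}"
        using Bc_cases Bd_cases by blast
      then show ?thesis
      proof cases
        case 1 then show ?thesis using Bb_bound x0 by blast
      next
        case 2 then show ?thesis using Bb_bound by blast
      next
        case 3
        then have "Bb = {}" using sub_b by auto
        then show ?thesis using bound[of "{z}" x B'] 3 B' pos[of z] by auto
      qed
    next
      case False
      \<comment> \<open>More than two items in \<open>Bb\<close> means two from M1 and the M2 item.
        Steps (c) and (d) then add nothing, and the M2 item serves as the extra one.\<close>
      then have "C \<inter> m2 \<noteq> {}" "Ba \<noteq> {}" using card_b card_m2 card_a by auto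
      then obtain y where y: "y \<in> C \<inter> m2" by blast
      then have Bb': "Bb \<subseteq> insert y Ba" using Bb nogood_22[OF ng] by blast
      have "C \<inter> m3 = {}" using nogood_13[OF ng] \<open>Ba \<noteq> {}\<close> sub_a by blast
      then have "Bd = Bb" using Bc_cases Bd_cases False by blast
      moreover have "sum s Ba \<le> 1"
      proof -
        have "sum s Ba \<le> real (card Ba) * (1 / 2)"
          using half Bb by (intro sum_bounded_above) (auto intro: less_imp_le)
        then show ?thesis using card_a by simp
      qed
      ultimately show ?thesis using bound[of Ba y B'] Bb' y sub_a B' by blast
    qed
  qed (use r_pos in simp)
  ultimately show ?thesis by blast
qed

section \<open>Comparing feasible sets of medium items with the buffer\<close>

lemma medium_cases:
  assumes "x \<notin> sm" "s x < r"
  obtains "x \<in> m1" | "x \<in> m2" | "x \<in> m3" | "x \<in> m4"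
  using assms unfolding class_iffs by argo

lemma not_small: "x \<in> m1 \<Longrightarrow> x \<notin> sm" "x \<in> m2 \<Longrightarrow> x \<notin> sm" "x \<in> m3 \<Longrightarrow> x \<notin> sm" "x \<in> m4 \<Longrightarrow> x \<notin> sm"
  using r_bounds by (auto simp: class_iffs)

context
  fixes U B :: "nat set"
  assumes cov: "covers U B" and sep: "separated U" and ng: "nogood B"
    and pos: "\<And>e. e \<in> U \<Longrightarrow> 0 < s e"
begin

text \<open>Small items are left out of \<open>Z\<close>; they are added to both sides at the very end.\<close>

definition attains :: "real \<Rightarrow> bool" where
  "attains v \<longleftrightarrow> (\<exists>Z\<subseteq>B - sm. sum s Z \<le> 1 \<and> v \<le> sum s Z)"

lemma attains_single: "p \<in> B \<Longrightarrow> p \<notin> sm \<Longrightarrow> v \<le> s p \<Longrightarrow> attains v"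
  using separatedD(1)[OF sep, of p] coversD(1)[OF cov] r_le unfolding attains_def
  by (intro exI[of _ "{p}"]) auto

lemma attains_pair:
  "p \<in> B \<Longrightarrow> p \<notin> sm \<Longrightarrow> q \<in> B \<Longrightarrow> q \<notin> sm \<Longrightarrow> p \<noteq> q \<Longrightarrow> s p + s q \<le> 1 \<Longrightarrow> v \<le> s p + s q \<Longrightarrow> attains v"
  unfolding attains_def by (intro exI[of _ "{p, q}"]) auto

lemmas cover = coversD[OF cov] and sepa = separatedD[OF sep]

text \<open>If the M4 items were given up for a pair \<open>p\<close>, \<open>q\<close> beside an M2
  item \<open>c\<close>, the triple exceeds 1. Since \<open>s p < r / 2\<close>, the pair
  \<open>q\<close>, \<open>c\<close> has more than \<open>1 - r / 2\<close>, which is at least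
  \<open>r\<^sup>2\<close>, and it is feasible.\<close>

lemma attains_m4:
  assumes "d \<in> U" "d \<in> m4" shows "attains (r\<^sup>2)"
proof -
  consider (a) d' where "d' \<in> B" "d' \<in> m4"
    | (b) p q c where "p \<in> B" "p \<in> m1" "q \<in> B" "q \<in> m1" "p \<noteq> q" "c \<in> B" "c \<in> m2"
    using cover(7)[OF assms] by blast
  then show ?thesis
  proof cases
    case a then show ?thesis using attains_single[of d'] not_small by (auto simp: class_iffs)
  next
    case b
    then have "1 < s p + s q + s c" using nogood_112[OF ng] by blast
    then have "r\<^sup>2 \<le> s q + s c" using b r_bounds unfolding class_iffs by argo
    moreover have "q \<noteq> c" using b by (auto simp: class_iffs)
    moreover have "s q + s c < r" using nogood_12[OF ng] b by blast
    ultimately show ?thesis using attains_pair[of q c] b not_small r_le by auto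
  qed
qed

lemma attains_mono: "attains v \<Longrightarrow> w \<le> v \<Longrightarrow> attains w"
  unfolding attains_def by (meson order_trans)

lemma m1_pair_or_m4:
  assumes "x \<in> U" "x \<in> m1" "y \<in> U" "y \<in> m1" "x \<noteq> y"
  obtains (pair) p q where "p \<in> B" "p \<in> m1" "q \<in> B" "q \<in> m1" "p \<noteq> q" "s p + s q \<le> s x + s y"
    | (m4) d where "d \<in> B" "d \<in> m4" "s d < s x + s y"
  using cover(5)[OF assms] by blast

text \<open>M4 reaches from \<open>r\<^sup>2\<close> to \<open>r\<close>, so trading within it loses
  exactly a factor \<open>r\<close>; M3 reaches from \<open>1 / 2\<close> to
  \<open>r\<^sup>2\<close>, where \<open>r ^ 3 < 1 / 2\<close> suffices.\<close>

lemma attains_one: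
  assumes y: "y \<in> U" "y \<notin> sm" shows "attains (r * s y)"
proof (cases "y \<in> B")
  case True
  have "r * s y \<le> 1 * s y" using r_le pos[OF y(1)] by (intro mult_right_mono) auto
  then show ?thesis using attains_single True y by auto
next
  case False
  have ry: "r * s y \<le> r * t" if "s y \<le> t" for t
    using that r_pos by simp
  show ?thesis using y(2) sepa(1)[OF y(1)]
  proof (cases y rule: medium_cases)
    case 1
    then obtain p where p: "p \<in> B" "p \<in> m1" using cover(4) y by blast
    have ub: "r * s y \<le> r\<^sup>2 / 2" using ry[of "r / 2"] 1 by (auto simp: class_iffs power2_eq_square)
    \<comment> \<open>The discarded item and its representative are two distinct M1 items, so
      \<open>covers\<close> yields a pair or an M4 item in the buffer.\<close>
    have "p \<in> U" "p \<noteq> y" using p False cover(1) by auto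
    show ?thesis
    proof (rule m1_pair_or_m4[OF \<open>p \<in> U\<close> p(2) y(1) 1 \<open>p \<noteq> y\<close>])
      fix p q assume pair: "p \<in> B" "p \<in> m1" "q \<in> B" "q \<in> m1" "p \<noteq> q"
      then have "r * s y \<le> s p + s q" "s p + s q \<le> 1"
        using ub r_bounds unfolding class_iffs by argo+
      then show ?thesis using attains_pair[of p q] pair not_small by auto
    next
      fix d assume m4: "d \<in> B" "d \<in> m4"
      then have "r * s y \<le> s d" using ub r_bounds unfolding class_iffs by argo
      then show ?thesis using attains_single m4 not_small by auto
    qed
  next
    case 2 then show ?thesis using cover(3) y False by blast
  next
    case 3
    have ub: "r * s y \<le> r ^ 3"
      using ry[of "r\<^sup>2"] 3 by (auto simp: class_iffs power2_eq_square power3_eq_cube)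
    consider (a) p where "p \<in> B" "p \<in> m3" | (b) d where "d \<in> U" "d \<in> m4"
      using cover(6)[OF y(1) 3] by blast
    then show ?thesis
    proof cases
      case a
      then have "r * s y \<le> s p" using ub r_cube_le r_bounds unfolding class_iffs by argo
      then show ?thesis using attains_single a not_small by auto
    next
      case b
      have "r * s y \<le> r\<^sup>2" using ub r_cube_le r_sq by argo
      then show ?thesis using attains_m4 b attains_mono by blast
    qed
  next
    case 4
    have "r * s y \<le> r\<^sup>2" using ry[of r] 4 by (auto simp: class_iffs power2_eq_square)
    then show ?thesis using attains_m4 4 y attains_mono by blast
  qed
qed

text \<open>The target is at most \<open>r\<^sup>2\<close>. If the buffer holds a pair other than
  \<open>{x, y}\<close>, one of \<open>x\<close>, \<open>y\<close> is a third M1 item; being below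
  \<open>r / 2\<close>, it leaves more than \<open>1 - r / 2\<close> to the pair.\<close>

lemma attains_11:
  assumes x: "x \<in> U" "x \<in> m1" and y: "y \<in> U" "y \<in> m1" and "x \<noteq> y"
  shows "attains (r * (s x + s y))"
proof -
  have lt: "s x + s y < r" using x y unfolding class_iffs by argo
  then have ub: "r * (s x + s y) \<le> r\<^sup>2" using r_pos by (simp add: power2_eq_square)
  show ?thesis
  proof (rule m1_pair_or_m4[OF x y \<open>x \<noteq> y\<close>])
    fix d assume "d \<in> B" "d \<in> m4"
    then have "attains (r\<^sup>2)" using attains_m4 cover(1) by blast
    then show ?thesis using ub attains_mono by blast
  next
    fix p q assume pq: "p \<in> B" "p \<in> m1" "q \<in> B" "q \<in> m1" "p \<noteq> q" "s p + s q \<le> s x + s y"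
    have le1: "s p + s q \<le> 1" using pq lt r_le by argo
    have "r * (s x + s y) \<le> s p + s q"
    proof (cases "{x, y} = {p, q}")
      case True
      have "r * (s x + s y) \<le> 1 * (s x + s y)"
        using r_le pos[OF x(1)] pos[OF y(1)] by (intro mult_right_mono) auto
      moreover have "s x + s y = s p + s q" using True by (auto simp: doubleton_eq_iff)
      ultimately show ?thesis by simp
    next
      case False
      then obtain w where w: "w \<in> U" "w \<in> m1" "w \<noteq> p" "w \<noteq> q"
        using x y \<open>x \<noteq> y\<close> by blast
      then have "1 < s p + s q + s w" using sepa(8)[of p q w] pq cover(1) by blast
      then show ?thesis using ub w(2) r_bounds unfolding class_iffs by argo
    qed
    then show ?thesis using attains_pair[of p q] pq le1 not_small by auto
  qed
qed

text \<open>The M2 item \<open>c\<close> is always kept. If \<open>x\<close> is gone, either the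
  larger of two kept M1 items joins \<open>c\<close>, or a kept M4 item suffices alone.\<close>

lemma attains_12:
  assumes x: "x \<in> U" "x \<in> m1" and c: "c \<in> U" "c \<in> m2"
  shows "attains (r * (s x + s c))"
proof -
  have cB: "c \<in> B" using cover(3) c by blast
  have xr: "s x * r \<le> r\<^sup>2 / 2" using x r_pos by (auto simp: class_iffs power2_eq_square)
  have pair: "attains (r * (s x + s c))"
    if p: "p \<in> B" "p \<in> m1" and le: "r * (s x + s c) \<le> s p + s c" for p
  proof -
    have "s p + s c < r" using nogood_12[OF ng] p cB c by blast
    moreover have "p \<noteq> c" using p(2) c(2) by (auto simp: class_iffs)
    ultimately show ?thesis using attains_pair[of p c] p cB c not_small r_le le by auto
  qed
  show ?thesis
  proof (cases "x \<in> B")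
    case True
    have "r * (s x + s c) \<le> 1 * (s x + s c)"
      using r_le pos[OF x(1)] pos[OF c(1)] by (intro mult_right_mono) auto
    then show ?thesis using pair[OF True x(2)] by simp
  next
    case False
    obtain p where p: "p \<in> B" "p \<in> m1" "s p \<le> s x" using cover(4) x by blast
    have pU: "p \<in> U" "p \<noteq> x" using p False cover(1) by auto
    show ?thesis
    proof (rule m1_pair_or_m4[OF pU(1) p(2) x pU(2)])
      fix p q assume pq: "p \<in> B" "p \<in> m1" "q \<in> B" "q \<in> m1" "p \<noteq> q"
      have three: "1 < s p + s q + s x" using sepa(8)[of p q x] pq x cover(1) False by blast
      \<comment> \<open>Scaling by \<open>r\<close> saves this much on \<open>c\<close>. With
        \<open>three\<close>, the larger of \<open>p\<close>, \<open>q\<close> exceeds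
        \<open>1 / 2 - r / 4\<close>, and the two together pay for \<open>x\<close>.\<close>
      have "(1 - r) * (r / 2) \<le> (1 - r) * s c"
        using c r_le by (intro mult_left_mono) (auto simp: class_iffs)
      then have cr: "r / 2 - r\<^sup>2 / 2 \<le> s c - r * s c" by (simp add: field_simps power2_eq_square)
      have "r * (s x + s c) = s x * r + r * s c" by (simp add: algebra_simps)
      then have "r * (s x + s c) \<le> s p + s c \<or> r * (s x + s c) \<le> s q + s c"
        using three cr xr x(2) r_bounds unfolding class_iffs by argo
      then show ?thesis using pair pq by blast
    next
      fix d assume d: "d \<in> B" "d \<in> m4"
      \<comment> \<open>Both bounds go through the same \<open>p\<close>: a large \<open>c\<close>
        forces a small \<open>p\<close>, and that forces a large \<open>d\<close>.\<close>
      have "1 < s p + s d" "s p + s c < r"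
        using nogood_14[OF ng] nogood_12[OF ng] p d cB c by blast+
      moreover from this have "r * (s x + s c) \<le> r * (r / 2 + r - s p)"
        using x(2) r_pos by (intro mult_left_mono) (auto simp: class_iffs)
      then have "r * (s x + s c) \<le> 3 / 2 * r\<^sup>2 - r * s p"
        by (simp add: algebra_simps power2_eq_square)
      moreover have "(1 - r) * s p \<le> (1 - r) * (r / 2)"
        using p(2) r_le by (intro mult_left_mono) (auto simp: class_iffs)
      then have "s p - r * s p \<le> r / 2 - r\<^sup>2 / 2"
        by (simp add: field_simps power2_eq_square)
      ultimately have "r * (s x + s c) \<le> s d" using r_sq_le r_le by linarith
      then show ?thesis using attains_single d not_small by auto
    qed
  qed
qed

lemma attains_13:
  assumes x: "x \<in> U" "x \<in> m1" and z: "z \<in> U" "z \<in> m3"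
  shows "attains (r * (s x + s z))"
proof -
  obtain c where c: "c \<in> U" "c \<in> m2" "s c + s x < r" using sepa(7)[OF x z] by blast
  have cB: "c \<in> B" using cover(3) c by blast
  obtain p where p: "p \<in> B" "p \<in> m1" "s p \<le> s x" using cover(4) x by blast
  have cz: "1 < s c + s z" using sepa(4) c z by blast
  \<comment> \<open>The M2 item links the two sizes: \<open>s x < r - s c\<close> and
    \<open>s c > 1 - s z\<close>.\<close>
  have "r * (s x + s z) \<le> r * (r - 1 + 2 * s z)"
    using cz c(3) r_pos by (intro mult_left_mono) auto
  also have "\<dots> = r\<^sup>2 - r + 2 * (r * s z)" by (simp add: algebra_simps power2_eq_square)
  also have "\<dots> \<le> r\<^sup>2 - r + 2 * r ^ 3"
    using z(2) r_pos by (simp add: class_iffs power2_eq_square power3_eq_cube)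
  \<comment> \<open>As \<open>s p > 1 - r\<close> and \<open>s c > 1 - r\<^sup>2\<close>, it is
    enough that \<open>r\<^sup>2 + r ^ 3 \<le> 1\<close>.\<close>
  also have "\<dots> \<le> s p + s c"
    using p(2) cz z(2) r_cube_le r_bounds unfolding class_iffs by argo
  finally have le: "r * (s x + s z) \<le> s p + s c" .
  have "s p + s c < r" using nogood_12[OF ng] p cB c by blast
  moreover have "p \<noteq> c" using p(2) c(2) by (auto simp: class_iffs)
  ultimately show ?thesis using attains_pair[of p c] p cB c not_small r_le le by auto
qed

text \<open>With \<open>x\<close> the smaller item, only an M1 item with one of M1, M2 or M3 can be
  feasible; \<open>separated\<close> and the size bounds rule out the rest.\<close>

lemma attains_two:
  assumes x: "x \<in> U" "x \<notin> sm" and y: "y \<in> U" "y \<notin> sm" and "x \<noteq> y" "s x + s y \<le> 1" "s x \<le> s y"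
  shows "attains (r * (s x + s y))"
  using x(2) sepa(1)[OF x(1)]
proof (cases x rule: medium_cases)
  case x1: 1
  from y(2) sepa(1)[OF y(1)] show ?thesis
  proof (cases y rule: medium_cases)
    case 1 then show ?thesis using attains_11 x x1 y \<open>x \<noteq> y\<close> by blast
  next
    case 2 then show ?thesis using attains_12 x x1 y by blast
  next
    case 3 then show ?thesis using attains_13 x x1 y by blast
  next
    case 4 then show ?thesis using sepa(2)[of x y] x x1 y assms(6) by auto
  qed
next
  case x2: 2
  have "y \<notin> m1" using x2 assms(7) by (auto simp: class_iffs)
  from y(2) sepa(1)[OF y(1)] show ?thesis
  proof (cases y rule: medium_cases)
    case 2 then show ?thesis using sepa(6)[of x y] x x2 y assms(5) by auto
  next
    case 3 then show ?thesis using sepa(4)[of x y] x x2 y assms(6) by auto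
  next
    case 4 then show ?thesis using sepa(3)[of x y] x x2 y assms(6) by auto
  qed (use \<open>y \<notin> m1\<close> in blast)
next
  case x3: 3
  have "y \<in> m3"
    using x3 assms(6,7) r_bounds by (auto simp: class_iffs)
  then show ?thesis using sepa(5)[of x y] x x3 y assms(5,6) by auto
next
  case 4
  then show ?thesis using assms(6,7) r_bounds by (auto simp: class_iffs)
qed

text \<open>Non-small items exceed \<open>1 / 4\<close>, so in a feasible triple each is below
  \<open>1 / 2\<close>. All three then lie in M1 or M2, at most one of them in M2.\<close>

lemma no_three:
  assumes U: "x \<in> U" "y \<in> U" "z \<in> U" and nsm: "x \<notin> sm" "y \<notin> sm" "z \<notin> sm"
    and ne: "x \<noteq> y" "x \<noteq> z" "y \<noteq> z"
  shows "1 < s x + s y + s z"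
proof (rule ccontr)
  assume le: "\<not> ?thesis"
  have cl: "w \<in> m1 \<or> w \<in> m2" if "w \<notin> sm" "s w < 1 / 2" for w
    using that unfolding class_iffs by argo
  have "s x < 1 / 2" "s y < 1 / 2" "s z < 1 / 2"
    using le nsm r_bounds unfolding class_iffs by argo+
  then have "x \<in> m1 \<or> x \<in> m2" "y \<in> m1 \<or> y \<in> m2" "z \<in> m1 \<or> z \<in> m2" using cl nsm by blast+
  moreover have "\<not> (v \<in> m2 \<and> w \<in> m2)" if "v \<in> U" "w \<in> U" "v \<noteq> w" for v w
    using that sepa(6) by blast
  ultimately consider "x \<in> m1" "y \<in> m1" "z \<in> m1" | "x \<in> m1" "y \<in> m1" "z \<in> m2"
    | "x \<in> m1" "y \<in> m2" "z \<in> m1" | "x \<in> m2" "y \<in> m1" "z \<in> m1"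
    using U ne by metis
  then show False
  proof cases
    case 1 then show ?thesis using le sepa(8)[of x y z] U ne by blast
  next
    case 2 then show ?thesis using le sepa(9)[of x y z] U ne by blast
  next
    case 3
    then have "1 < s x + s z + s y" using sepa(9) U ne by blast
    then show ?thesis using le by simp
  next
    case 4
    then have "1 < s y + s z + s x" using sepa(9) U ne by blast
    then show ?thesis using le by simp
  qed
qed

lemma attains_medium:
  assumes Y: "Y \<subseteq> U - sm" "finite Y" "sum s Y \<le> 1" shows "attains (r * sum s Y)"
proof -
  have "card Y < 4"
  proof (cases "Y = {}")
    case False
    have "1 / 4 < s y" if "y \<in> Y" for y
    proof -
      have "y \<notin> sm" using that Y(1) by blast
      then show ?thesis using r_le unfolding class_iffs by argo
    qed
    then have "(\<Sum>y\<in>Y. 1 / 4) < sum s Y" using False Y(2) by (intro sum_strict_mono) auto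
    then show ?thesis using Y(3) by simp
  qed simp
  then consider "card Y = 0" | "card Y = 1" | "card Y = 2" | "card Y = 3" by linarith
  then show ?thesis
  proof cases
    case 1
    then have "Y = {}" using Y by simp
    then show ?thesis unfolding attains_def by (intro exI[of _ "{}"]) auto
  next
    case 2
    then obtain y where "Y = {y}" by (auto simp: card_1_singleton_iff)
    then show ?thesis using attains_one[of y] Y by auto
  next
    case 3
    then obtain x y where xy: "Y = {x, y}" "x \<noteq> y" by (auto simp: card_2_iff)
    then show ?thesis
      using attains_two[of x y] attains_two[of y x] Y by (cases "s x \<le> s y") (auto simp: add.commute)
  next
    case 4
    then obtain x y z where "Y = {x, y, z}" "x \<noteq> y" "x \<noteq> z" "y \<noteq> z" by (auto simp: card_3_iff)
    then show ?thesis using no_three[of x y z] Y by (auto simp: add.assoc)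
  qed
qed

text \<open>The buffer contains every small item seen, and by \<open>nogood_small\<close> all of
  them fit on top of the set that matches the medium part of \<open>X\<close>.\<close>

lemma near_optimal:
  assumes "X \<subseteq> U" "finite U" "sum s X \<le> 1"
  shows "\<exists>Z\<subseteq>B. sum s Z \<le> 1 \<and> r * sum s X \<le> sum s Z"
proof -
  have fX: "finite X" and fB: "finite B" using assms cover(1) finite_subset by blast+
  have split: "sum s X = sum s (X - sm) + sum s (X \<inter> sm)"
    using sum.Int_Diff[OF fX, of s sm] by simp
  have nn: "0 \<le> sum s (X \<inter> sm)"
    using pos assms(1) by (intro sum_nonneg less_imp_le) blast
  then have "attains (r * sum s (X - sm))" using attains_medium[of "X - sm"] assms split fX by auto
  then obtain Z where Z: "Z \<subseteq> B - sm" "sum s Z \<le> 1" "r * sum s (X - sm) \<le> sum s Z"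
    unfolding attains_def by blast
  have "sum s (Z \<union> (B \<inter> sm)) < r" using nogood_small[OF ng _ Z(2) fB] Z(1) by auto
  moreover have "sum s (Z \<union> (B \<inter> sm)) = sum s Z + sum s (B \<inter> sm)"
    using Z(1) fB finite_subset[of Z B] by (intro sum.union_disjoint) auto
  moreover have "sum s (X \<inter> sm) \<le> sum s (B \<inter> sm)"
  proof (rule sum_mono2)
    show "X \<inter> sm \<subseteq> B \<inter> sm" using cover(2) assms(1) by blast
    show "0 \<le> s i" if "i \<in> B \<inter> sm - X \<inter> sm" for i
      using that pos[of i] cover(1) by (intro less_imp_le) blast
  qed (use fB in simp)
  moreover have "r * sum s (X \<inter> sm) \<le> 1 * sum s (X \<inter> sm)"
    using nn r_le by (intro mult_right_mono) auto
  ultimately show ?thesis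
    using Z split r_le by (intro exI[of _ "Z \<union> (B \<inter> sm)"]) (auto simp: distrib_left)
qed

end

section \<open>The invariant of the whole run\<close>

definition state :: "nat set \<Rightarrow> nat set \<Rightarrow> bool" where
  "state U B \<longleftrightarrow> (B \<subseteq> U \<and> r \<le> sum s B \<and> sum s B \<le> 1) \<or> (covers U B \<and> separated U \<and> nogood B)"

lemma state_subset: "state U B \<Longrightarrow> B \<subseteq> U"
  unfolding state_def covers_def by blast

lemma state_empty: "state {} {}"
  unfolding state_def covers_def separated_def nogood_def using r_pos by auto

text \<open>The first disjunct of \<open>state\<close> is absorbing: a good buffer is itself a good
  subset in the next round. The other is carried on by \<open>covers_insert\<close>,
  \<open>covers_trans\<close> and \<open>separated_insert\<close>.\<close>

lemma state_round:
  assumes st: "state U B" and e: "e \<notin> U" and fin: "finite U"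
    and pos: "\<And>i. i \<in> insert e U \<Longrightarrow> 0 < s i \<and> s i \<le> 1"
    and rnd: "algorithm_round (2 * r) s (insert e B) B'"
  shows "state (insert e U) B' \<and> sum s B' \<le> 2 * r"
proof (cases "\<exists>X. X \<subseteq> insert e B \<and> 2 * r / 2 \<le> sum s X \<and> sum s X \<le> 1")
  case True
  then have "B' \<subseteq> insert e B" "r \<le> sum s B'" "sum s B' \<le> 1"
    using rnd unfolding algorithm_round_def Let_def by auto
  then show ?thesis using state_subset[OF st] r_gt unfolding state_def by auto
next
  case False
  then have ng: "nogood (insert e B)" unfolding nogood_def by (auto simp: not_le)
  have "\<not> (r \<le> sum s B \<and> sum s B \<le> 1)" using False by auto
  then have cov: "covers U B" and sep: "separated U" using st unfolding state_def by auto
  have BU: "B \<subseteq> U" using state_subset[OF st] .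
  then have fB: "finite (insert e B)" using fin finite_subset by auto
  have step: "covers (insert e B) B'" "sum s B' \<le> 2 * r"
    using round_step[OF ng fB _ rnd] pos BU by auto
  have "covers (insert e U) B'" using covers_trans[OF covers_insert[OF cov e] step(1)] .
  moreover have "separated (insert e U)" using separated_insert[OF cov sep e _ ng] pos by auto
  moreover have "nogood B'" using nogood_mono[OF ng] coversD(1)[OF step(1)] by blast
  ultimately show ?thesis using step(2) unfolding state_def by blast
qed

lemma state_near_optimal:
  assumes "state U B" "finite U" "\<And>i. i \<in> U \<Longrightarrow> 0 < s i" "X \<subseteq> U" "sum s X \<le> 1"
  shows "\<exists>Z\<subseteq>B. sum s Z \<le> 1 \<and> r * sum s X \<le> sum s Z"
proof (cases "covers U B \<and> separated U \<and> nogood B")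
  case True
  then show ?thesis using near_optimal[of U B X] assms by blast
next
  case False
  have "r * sum s X \<le> r * 1" using assms(5) r_pos by (intro mult_left_mono) auto
  then show ?thesis using False assms(1) unfolding state_def by (intro exI[of _ B]) auto
qed

text \<open>
  Appending an item changes the size function \<open>\<lambda>i. isize (I ! i)\<close> at all positions outside the list,
  where \<open>nth\<close> yields junk.
\<close>

lemma state_cong:
  assumes agree: "\<And>i. i \<in> U \<Longrightarrow> s' i = s i" and st: "state U B"
  shows "buffer_knapsack.state r s' U B"
proof -
  interpret s': buffer_knapsack r s' by unfold_locales
  have BU: "B \<subseteq> U" using state_subset[OF st] .
  have agreeB: "\<And>i. i \<in> B \<Longrightarrow> s' i = s i" using agree BU by blast
  have eqU: "U \<inter> s'.sm = U \<inter> sm" "U \<inter> s'.m1 = U \<inter> m1" "U \<inter> s'.m2 = U \<inter> m2"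
    "U \<inter> s'.m3 = U \<inter> m3" "U \<inter> s'.m4 = U \<inter> m4"
    using agree by (auto simp: class_iffs s'.class_iffs)
  have eqB: "B \<inter> s'.m1 = B \<inter> m1" "B \<inter> s'.m2 = B \<inter> m2" "B \<inter> s'.m3 = B \<inter> m3" "B \<inter> s'.m4 = B \<inter> m4"
    using agreeB by (auto simp: class_iffs s'.class_iffs)
  have "sum s' X = sum s X" if "X \<subseteq> B" for X
    using that agreeB by (intro sum.cong) auto
  then have "s'.nogood B = nogood B" "sum s' B = sum s B"
    unfolding nogood_def s'.nogood_def by auto
  moreover have "s'.separated U = separated U"
    unfolding separated_def s'.separated_def eqU
    by (simp add: agree cong: ball_cong_simp bex_cong_simp)
  moreover have "s'.covers U B = covers U B"
    unfolding covers_def s'.covers_def eqU eqB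
    by (simp add: agree agreeB cong: ball_cong_simp bex_cong_simp)
  ultimately show ?thesis using st unfolding state_def s'.state_def by simp
qed

end

section \<open>Optimal values and existence of an implementation\<close>

lemma best_value_ge:
  assumes "finite C" "Z \<subseteq> C" "total_size I Z \<le> 1"
  shows "total_value I Z \<le> best_value I C"
proof -
  have "{total_value I B |B. B \<subseteq> C \<and> total_size I B \<le> 1} \<subseteq> total_value I ` Pow C" by auto
  then have "finite {total_value I B |B. B \<subseteq> C \<and> total_size I B \<le> 1}"
    using assms(1) finite_subset by blast
  then show ?thesis unfolding best_value_def using assms by (intro Max_ge) auto
qed

lemma best_value_attained:
  assumes "finite C"
  obtains Z where "Z \<subseteq> C" "total_size I Z \<le> 1" "best_value I C = total_value I Z"
proof -
  let ?V = "{total_value I B |B. B \<subseteq> C \<and> total_size I B \<le> 1}"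
  have "?V \<subseteq> total_value I ` Pow C" by auto
  then have "finite ?V" using assms finite_subset by blast
  moreover have "?V \<noteq> {}" by (auto simp: total_size_def intro!: exI[of _ "{}"])
  ultimately have "Max ?V \<in> ?V" by (rule Max_in)
  then show ?thesis using that unfolding best_value_def by blast
qed

text \<open>The items come in reverse order of arrival.\<close>

primrec run_rev :: "real \<Rightarrow> item list \<Rightarrow> nat set" where
  "run_rev R [] = {}"
| "run_rev R (e # J) = (SOME B. algorithm_round R (\<lambda>i. isize (rev (e # J) ! i))
     (insert (length J) (run_rev R J)) B)"

text \<open>Ties are broken by choice. Finiteness of the buffers is shown first, since only then is
  a round known to have an outcome.\<close>

lemma ex_implements_algorithm: "\<exists>alg. implements_algorithm P R alg"
proof -
  have fin: "finite (run_rev R J)" for J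
  proof (induction J)
    case (Cons e J)
    have "\<exists>B. algorithm_round R (\<lambda>i. isize (rev (e # J) ! i)) (insert (length J) (run_rev R J)) B"
      using ex_algorithm_round Cons by simp
    from someI_ex[OF this] have "run_rev R (e # J) \<subseteq> insert (length J) (run_rev R J)"
      using algorithm_round_subset by simp
    then show ?case using Cons finite_subset by blast
  qed simp
  have "algorithm_round R (\<lambda>i. isize ((I @ [e]) ! i)) (insert (length I) (run_rev R (rev I)))
      (run_rev R (rev (I @ [e])))" for I e
  proof -
    have "\<exists>B. algorithm_round R (\<lambda>i. isize ((I @ [e]) ! i)) (insert (length I) (run_rev R (rev I))) B"
      using ex_algorithm_round fin by simp
    from someI_ex[OF this] show ?thesis by simp
  qed
  then show ?thesis
    unfolding implements_algorithm_def by (intro exI[of _ "\<lambda>I. run_rev R (rev I)"]) simp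
qed

section \<open>From single rounds to competitiveness\<close>

context buffer_knapsack
begin

lemma implements_state:
  assumes impl: "implements_algorithm proportional_inputs (2 * r) alg"
  shows "I \<in> proportional_inputs \<Longrightarrow>
    buffer_knapsack.state r (\<lambda>i. isize (I ! i)) {..<length I} (alg I) \<and> total_size I (alg I) \<le> 2 * r"
proof (induction I rule: rev_induct)
  case Nil
  interpret nil: buffer_knapsack r "\<lambda>i. isize ([] ! i)" by unfold_locales
  show ?case
    using impl nil.state_empty r_pos unfolding implements_algorithm_def total_size_def by simp
next
  case (snoc e I)
  interpret old: buffer_knapsack r "\<lambda>i. isize (I ! i)" by unfold_locales
  interpret new: buffer_knapsack r "\<lambda>i. isize ((I @ [e]) ! i)" by unfold_locales
  have "I \<in> proportional_inputs"
    using snoc.prems by (auto simp: proportional_inputs_def inputs_def)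
  then have "old.state {..<length I} (alg I)" using snoc.IH by blast
  \<comment> \<open>The invariant is moved to the size function of the longer list, which agrees on
    all earlier positions.\<close>
  then have st: "new.state {..<length I} (alg I)" by (rule old.state_cong[rotated]) (simp add: nth_append)
  have pos: "0 < isize ((I @ [e]) ! i) \<and> isize ((I @ [e]) ! i) \<le> 1"
    if "i \<in> insert (length I) {..<length I}" for i
  proof -
    have "(I @ [e]) ! i \<in> set (I @ [e])" using that by (intro nth_mem) auto
    then show ?thesis using snoc.prems unfolding proportional_inputs_def inputs_def by blast
  qed
  have "algorithm_round (2 * r) (\<lambda>i. isize ((I @ [e]) ! i)) (insert (length I) (alg I))
      (alg (I @ [e]))"
    using impl snoc.prems unfolding implements_algorithm_def by blast
  from new.state_round[OF st _ _ pos this] show ?case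
    by (simp add: lessThan_Suc total_size_def)
qed

lemma implements_competitive:
  assumes impl: "implements_algorithm proportional_inputs (2 * r) alg"
    and I: "I \<in> proportional_inputs"
  shows "r * OPT I \<le> ALG alg I"
proof -
  interpret final: buffer_knapsack r "\<lambda>i. isize (I ! i)" by unfold_locales
  have st: "final.state {..<length I} (alg I)" using implements_state[OF impl I] by blast
  have pos: "0 < isize (I ! i)" and eq: "ivalue (I ! i) = isize (I ! i)" if "i < length I" for i
    using I nth_mem[OF that] unfolding proportional_inputs_def inputs_def by blast+
  have val: "total_value I Z = total_size I Z" if "Z \<subseteq> {..<length I}" for Z
    unfolding total_value_def total_size_def using that eq by (intro sum.cong) auto
  have sub: "alg I \<subseteq> {..<length I}" using final.state_subset[OF st] .
  obtain X where X: "X \<subseteq> {..<length I}" "total_size I X \<le> 1" "OPT I = total_value I X"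
    using best_value_attained[of "{..<length I}" I] unfolding OPT_def by auto
  obtain Z where Z: "Z \<subseteq> alg I" "total_size I Z \<le> 1" "r * total_size I X \<le> total_size I Z"
    using final.state_near_optimal[OF st _ _ X(1)] X(2) pos unfolding total_size_def by auto
  have "total_value I Z \<le> ALG alg I"
    unfolding ALG_def using sub Z finite_subset by (intro best_value_ge) auto
  moreover have "Z \<subseteq> {..<length I}" using Z(1) sub by blast
  ultimately show ?thesis using X Z val by simp
qed

end

text \<open>The existence part keeps the claim about all tie breakings from being vacuous.\<close>

theorem theorem16:
  fixes R :: real
  assumes "2 * sqrt 3 - 2 \<le> R" and "R \<le> 3 / 2"
  shows "(\<exists>alg. implements_algorithm proportional_inputs R alg) \<and>
    (\<forall>alg. implements_algorithm proportional_inputs R alg \<longrightarrow>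
       removable_online_algorithm proportional_inputs R alg \<and>
       competitive proportional_inputs (2 / R) alg)"
proof -
  have R0: "0 < R" and sq: "1 / 2 < (R / 2)\<^sup>2"
  proof -
    \<comment> \<open>A rational lower bound for \<open>sqrt 3\<close>; it gives
      \<open>R / 2 \<ge> 73 / 100\<close>, whose square exceeds \<open>1 / 2\<close>.\<close>
    have "(173 / 100)\<^sup>2 \<le> (3 :: real)" by (simp add: power2_eq_square)
    then have "173 / 100 \<le> sqrt 3" by (rule real_le_rsqrt)
    then have R: "73 / 100 \<le> R / 2" using assms(1) by simp
    then show "0 < R" by simp
    have "(73 / 100) * (73 / 100) \<le> R / 2 * (R / 2)" using R by (intro mult_mono) auto
    then show "1 / 2 < (R / 2)\<^sup>2" by (simp add: power2_eq_square)
  qed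
  \<comment> \<open>The zero function is a placeholder: \<open>implements_state\<close> and
    \<open>implements_competitive\<close> interpret the locale again with the sizes of the input at
    hand.\<close>
  interpret buffer_knapsack "R / 2" "\<lambda>_. 0"
    using R0 sq assms(2) by unfold_locales auto
  have "removable_online_algorithm proportional_inputs R alg \<and>
      competitive proportional_inputs (2 / R) alg"
    if impl: "implements_algorithm proportional_inputs R alg" for alg
  proof
    have impl': "implements_algorithm proportional_inputs (2 * (R / 2)) alg" using impl by simp
    have "total_size I (alg I) \<le> R" if "I \<in> proportional_inputs" for I
      using implements_state[OF impl' that] by simp
    then show "removable_online_algorithm proportional_inputs R alg"
      using impl algorithm_round_subset
      unfolding removable_online_algorithm_def implements_algorithm_def by blast
    have "OPT I \<le> 2 / R * ALG alg I" if "I \<in> proportional_inputs" for I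
      using implements_competitive[OF impl' that] R0 by (simp add: field_simps)
    then show "competitive proportional_inputs (2 / R) alg" unfolding competitive_def by blast
  qed
  then show ?thesis using ex_implements_algorithm by blast
qed

end
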